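(* Let \[ b_n=\frac{q^{\nu+n+1}}{1-q^{\nu+n+1}},\qquad a_n =\frac{q^{2\nu+2n+1}}{(1-q^{\nu+n})(1-q^{\nu+n+1})} ,\qquad \lambda_n =0 \quad (n\ge0). \] Then for every $m\ge0$, \[ \frac{R_{m,\nu+2}(z;q^{-1})}{R_{m+1,\nu+1}(z;q^{-1})} = \frac{q^{\nu+1}z}{q^{\nu+1}-1} \sum_{n\ge0}\mu_n^{\le m}(b,a,\lambda) z^{2n}, \] and \[ \frac{J_{\nu+1}(z;q^{-1})}{J_{\nu}(z;q^{-1})} = \frac{q^{\nu+1}z}{q^{\nu+1}-1} \sum_{n\ge0}\mu_n(b,a,\lambda) z^{2n}. \]
   Context: For sequences $b,a,\lambda$, define $\mu^{\le m}_n(b,a,\lambda)$ and $\mu_n(b,a,\lambda)$ as the coefficients of the formal power series in $t$ \[ \sum_{n\ge0}\mu^{\le m}_n t^n=\cfrac{1}{1-b_0t-\cfrac{a_1t+\lambda_1t^2}{1-b_1t-\cdots-\cfrac{a_mt+\lambda_mt^2}{1-b_mt}}},\qquad \sum_{n\ge0}\mu_n t^n=\cfrac{1}{1-b_0t-\cfrac{a_1t+\lambda_1t^2}{1-b_1t-\cfrac{a_2t+\lambda_2t^2}{1-b_2t-\cdots}}} \] (the infinite continued fraction converges as a formal power series). The $q$-Lommel polynomials with base $p$ are defined by $R_{-1,\nu}(z;p)=0$, $R_{0,\nu}(z;p)=1$, $R_{m+1,\nu}(z;p)=(z+z^{-1}(1-p^{\nu+m}))R_{m,\nu}(z;p)-R_{m-1,\nu}(z;p)$.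 With $(a;p)_n=\prod_{i=0}^{n-1}(1-ap^i)$, the Hahn–Exton ratio with base $p=q^{-1}$ is the formal power series $\frac{J_{\nu+1}(w;p)}{J_\nu(w;p)}=\frac{w}{1-p^{\nu+1}}\frac{\Phi_{\nu+1}(w;p)}{\Phi_\nu(w;p)}$, $\Phi_\nu(w;p)=\sum_{n\ge0}\frac{(-1)^np^{\binom n2}(pw^2)^n}{(p;p)_n(p^{\nu+1};p)_n}$ (coming from $J_\nu(w;p)=\frac{(p^{\nu+1};p)_\infty w^\nu}{(p;p)_\infty}\Phi_\nu(w;p)$). Both identities are identities of formal power series in $z$ (rational functions of $z$ being expanded). *)

theory Defs
  imports "HOL-Computational_Algebra.Computational_Algebra"
begin

(* Powers of a base. The exponent nu is not an integer in general, so a base p together with its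
   powers p^s is represented by the function P = (%s. p^s) from a commutative ring of exponents to
   the coefficient field, subject to P 0 = 1 and P (s + t) = P s * P t; the base itself is P 1.
   This covers s |-> q powr s (q > 0 real), s |-> exp (s * L) with exp L = q (q complex), as well as
   the formal reading in which q and q^nu are indeterminates (exponents a + b * nu with integers
   a, b, inside the polynomial ring int[nu]). *)

definition recip_base :: "('e::comm_ring_1 \<Rightarrow> 'a::field) \<Rightarrow> 'e \<Rightarrow> 'a" where
  "recip_base Q = (\<lambda>s. Q (- s))"

(* cfrac_denom b a lam k j is the finite continued fraction
     1 - b_k t - (a_(k+1) t + lam_(k+1) t^2) / (1 - b_(k+1) t - ... / (1 - b_(k+j) t)). *)
fun cfrac_denom :: "(nat \<Rightarrow> 'a::field) \<Rightarrow> (nat \<Rightarrow> 'a) \<Rightarrow> (nat \<Rightarrow> 'a) \<Rightarrow> nat \<Rightarrow> nat \<Rightarrow> 'a fps" where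
  "cfrac_denom b a lam k 0 = 1 - fps_const (b k) * fps_X"
| "cfrac_denom b a lam k (Suc j) =
     1 - fps_const (b k) * fps_X
       - (fps_const (a (Suc k)) * fps_X + fps_const (lam (Suc k)) * fps_X ^ 2)
           / cfrac_denom b a lam (Suc k) j"

definition cfrac :: "(nat \<Rightarrow> 'a::field) \<Rightarrow> (nat \<Rightarrow> 'a) \<Rightarrow> (nat \<Rightarrow> 'a) \<Rightarrow> nat \<Rightarrow> 'a fps" where
  "cfrac b a lam m = 1 / cfrac_denom b a lam 0 m"

definition mu_le :: "nat \<Rightarrow> (nat \<Rightarrow> 'a::field) \<Rightarrow> (nat \<Rightarrow> 'a) \<Rightarrow> (nat \<Rightarrow> 'a) \<Rightarrow> nat \<Rightarrow> 'a" where
  "mu_le m b a lam n = fps_nth (cfrac b a lam m) n"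

(* The infinite continued fraction is the limit of its truncations in the X-adic topology;
   convergence is lemma convergent_cfrac below. *)
definition mu :: "(nat \<Rightarrow> 'a::field) \<Rightarrow> (nat \<Rightarrow> 'a) \<Rightarrow> (nat \<Rightarrow> 'a) \<Rightarrow> nat \<Rightarrow> 'a" where
  "mu b a lam n = fps_nth (lim (cfrac b a lam)) n"

(* R_(m,nu)(z;p), as a Laurent series in z over the coefficient field, with P s = p^s.
   The value at m = 1 is the recurrence at m = 0 with R_(-1,nu) = 0. *)
fun q_lommel :: "('e::comm_ring_1 \<Rightarrow> 'a::field) \<Rightarrow> 'e \<Rightarrow> nat \<Rightarrow> 'a fls" where
  "q_lommel P \<nu> 0 = 1"
| "q_lommel P \<nu> (Suc 0) = fls_X + fls_X_inv * fls_const (1 - P \<nu>)"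
| "q_lommel P \<nu> (Suc (Suc m)) =
     (fls_X + fls_X_inv * fls_const (1 - P (\<nu> + of_nat (Suc m)))) * q_lommel P \<nu> (Suc m)
       - q_lommel P \<nu> m"

definition q_pochhammer :: "'a::field \<Rightarrow> 'a \<Rightarrow> nat \<Rightarrow> 'a" where
  "q_pochhammer x p n = (\<Prod>i<n. 1 - x * p ^ i)"

(* Phi_nu(w;p); its n-th summand carries w^(2n), hence the substitution of X^2. *)
definition hahn_exton_Phi :: "('e::comm_ring_1 \<Rightarrow> 'a::field) \<Rightarrow> 'e \<Rightarrow> 'a fps" where
  "hahn_exton_Phi P \<nu> =
     Abs_fps (\<lambda>n. (-1) ^ n * P 1 ^ (n choose 2) * P 1 ^ n
                    / (q_pochhammer (P 1) (P 1) n * q_pochhammer (P (\<nu> + 1)) (P 1) n))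
       oo fps_X ^ 2"

(* J_(nu+1)(w;p) / J_nu(w;p) as a formal power series in w. *)
definition hahn_exton_ratio :: "('e::comm_ring_1 \<Rightarrow> 'a::field) \<Rightarrow> 'e \<Rightarrow> 'a fps" where
  "hahn_exton_ratio P \<nu> =
     fps_const (1 / (1 - P (\<nu> + 1))) * fps_X * (hahn_exton_Phi P (\<nu> + 1) / hahn_exton_Phi P \<nu>)"

lemma cfrac_denom_nth_0: "fps_nth (cfrac_denom b a lam k j) 0 = 1"
proof (induction j arbitrary: k)
  case (Suc j)
  then show ?case by (simp add: fps_divide_unit power2_eq_square)
qed simp

lemma inverse_diff_dvd:
  fixes f g :: "'a::field fps"
  assumes "fps_nth f 0 = 1" "fps_nth g 0 = 1" "d dvd f - g"
  shows "d dvd inverse f - inverse g"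
proof -
  have "f * inverse f = 1" "g * inverse g = 1"
    using assms by (simp_all add: inverse_mult_eq_1')
  then have "inverse f - inverse g = (f - g) * (- inverse f * inverse g)"
    by algebra
  with assms(3) show ?thesis by simp
qed

lemma cfrac_denom_Suc_dvd:
  "fps_X ^ Suc j dvd cfrac_denom b a lam k (Suc j) - cfrac_denom b a lam k j"
proof (induction j arbitrary: k)
  case 0
  have "fps_X dvd (fps_const (a (Suc k)) * fps_X + fps_const (lam (Suc k)) * fps_X ^ 2)
                    * inverse (cfrac_denom b a lam (Suc k) 0)"
    by (intro dvd_mult2 dvd_add dvd_mult) (simp_all add: power2_eq_square)
  then show ?case by (simp add: fps_divide_unit)
next
  case (Suc j)
  let ?D = "cfrac_denom b a lam"
  have step: "?D k (Suc i) = 1 - fps_const (b k) * fps_X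
      - (fps_const (a (Suc k)) * fps_X + fps_const (lam (Suc k)) * fps_X ^ 2)
          * inverse (?D (Suc k) i)" for i
    by (simp add: fps_divide_unit cfrac_denom_nth_0)
  have ring: "x - y * u - (x - y * v) = y * (v - u)" for x y u v :: "'a fps"
    by (simp add: algebra_simps)
  have "fps_X ^ Suc j dvd inverse (?D (Suc k) (Suc j)) - inverse (?D (Suc k) j)"
    using cfrac_denom_nth_0 cfrac_denom_nth_0 Suc by (rule inverse_diff_dvd)
  then have *: "fps_X ^ Suc j dvd inverse (?D (Suc k) j) - inverse (?D (Suc k) (Suc j))"
    by (subst dvd_diff_commute)
  have "fps_X dvd fps_const (a (Suc k)) * fps_X + fps_const (lam (Suc k)) * fps_X ^ 2"
    by (intro dvd_add dvd_mult) (simp_all add: power2_eq_square)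
  from mult_dvd_mono[OF this *] show ?case
    unfolding step ring by simp
qed

lemma cfrac_nth_stable:
  assumes "n \<le> m"
  shows "fps_nth (cfrac b a lam m) n = fps_nth (cfrac b a lam n) n"
  using assms
proof (induction m rule: dec_induct)
  case (step m)
  have "fps_X ^ Suc m dvd cfrac b a lam (Suc m) - cfrac b a lam m"
    using inverse_diff_dvd[OF cfrac_denom_nth_0 cfrac_denom_nth_0 cfrac_denom_Suc_dvd, of m b a lam 0]
    by (simp add: cfrac_def fps_divide_unit cfrac_denom_nth_0 del: cfrac_denom.simps power_Suc)
  then obtain h where "cfrac b a lam (Suc m) - cfrac b a lam m = fps_X ^ Suc m * h" ..
  then have "fps_nth (cfrac b a lam (Suc m)) n - fps_nth (cfrac b a lam m) n
      = fps_nth (fps_X ^ Suc m * h) n"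
    by (metis fps_sub_nth)
  also have "\<dots> = 0"
    using step.hyps by (subst fps_X_power_mult_nth) simp
  finally show ?case using step.IH by simp
qed simp

lemma convergent_cfrac: "convergent (cfrac b a lam)"
proof -
  have "cfrac b a lam \<longlonglongrightarrow> Abs_fps (\<lambda>n. fps_nth (cfrac b a lam n) n)"
  proof (rule tendsto_fpsI)
    fix n
    show "\<forall>\<^sub>F m in sequentially. fps_nth (cfrac b a lam m) n
            = fps_nth (Abs_fps (\<lambda>n. fps_nth (cfrac b a lam n) n)) n"
      unfolding fps_nth_Abs_fps
      using eventually_ge_at_top[of n] by eventually_elim (rule cfrac_nth_stable)
  qed
  then show ?thesis by (rule convergentI)
qed

end

theory Submission
  imports Defs
begin

text \<open>
  Put \<open>d k = 1 - p^(\<nu> + k)\<close>, so that \<open>b n = - 1 / d (n + 1)\<close> and \<open>a n = 1 / (d n * d (n + 1))\<close>. The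
  \<open>q\<close>-Lommel polynomials are continuants, hence expanding from the other end gives
  \<open>R_(m+1,\<nu>) = z\<inverse> (d 0 + z^2) R_(m,\<nu>+1) - R_(m-1,\<nu>+2)\<close>; dividing by \<open>R_(m,\<nu>+1)\<close> yields the
  recursion of the finite continued fraction. The contiguous relation between \<open>\<Phi>_\<nu>\<close>, \<open>\<Phi>_(\<nu>+1)\<close> and
  \<open>\<Phi>_(\<nu>+2)\<close> shows in the same way that the quotients \<open>\<Phi>_(\<nu>+k) / \<Phi>_(\<nu>+k+1)\<close> are the tails of the
  infinite one.
\<close>

section \<open>Tails of an infinite continued fraction\<close>

text \<open>Each level gains one order of \<open>fps_X\<close>: inverting series with constant term
  1 preserves divisibility of their difference, and the partial numerator contributes another factor
  \<open>fps_X\<close>. Truncating at depth 0 already omits only a multiple of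
  \<open>fps_X\<close>.\<close>

lemma cfrac_denom_tail_dvd:
  fixes G :: "nat \<Rightarrow> 'a::field fps"
  assumes G_0: "\<And>k. fps_nth (G k) 0 = 1"
    and G_rec: "\<And>k. G k = 1 - fps_const (b k) * fps_X
      - (fps_const (a (Suc k)) * fps_X + fps_const (lam (Suc k)) * fps_X ^ 2) / G (Suc k)"
  shows "fps_X ^ Suc j dvd G k - cfrac_denom b a lam k j"
proof (induction j arbitrary: k)
  case 0
  have "fps_X dvd (fps_const (a (Suc k)) * fps_X + fps_const (lam (Suc k)) * fps_X ^ 2)
                    * inverse (G (Suc k))"
    by (intro dvd_mult2 dvd_add dvd_mult) (simp_all add: power2_eq_square)
  then show ?case
    by (subst G_rec) (simp add: fps_divide_unit G_0)
next
  case (Suc j)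
  let ?D = "cfrac_denom b a lam"
    and ?N = "fps_const (a (Suc k)) * fps_X + fps_const (lam (Suc k)) * fps_X ^ 2"
  have "fps_X ^ Suc j dvd inverse (G (Suc k)) - inverse (?D (Suc k) j)"
    using G_0 cfrac_denom_nth_0 Suc by (rule inverse_diff_dvd)
  moreover have "fps_X dvd ?N"
    by (intro dvd_add dvd_mult) (simp_all add: power2_eq_square)
  ultimately have "fps_X * fps_X ^ Suc j dvd ?N * (inverse (G (Suc k)) - inverse (?D (Suc k) j))"
    by (rule mult_dvd_mono[rotated])
  moreover have "G k - ?D k (Suc j) = - (?N * (inverse (G (Suc k)) - inverse (?D (Suc k) j)))"
    by (subst G_rec) (simp add: fps_divide_unit G_0 cfrac_denom_nth_0 algebra_simps)
  ultimately show ?case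
    by simp
qed

text \<open>Solutions of the tail recursion with constant terms 1 are determined by it, so guessing
  the tails suffices to evaluate the fraction: the truncation at depth \<open>m\<close> already has
  the correct coefficients up to index \<open>m\<close>.\<close>

lemma lim_cfrac_eq_inverse_tail:
  fixes G :: "nat \<Rightarrow> 'a::field fps"
  assumes G_0: "\<And>k. fps_nth (G k) 0 = 1"
    and G_rec: "\<And>k. G k = 1 - fps_const (b k) * fps_X
      - (fps_const (a (Suc k)) * fps_X + fps_const (lam (Suc k)) * fps_X ^ 2) / G (Suc k)"
  shows "lim (cfrac b a lam) = inverse (G 0)"
proof (rule limI, rule tendsto_fpsI)
  fix n
  have "fps_nth (cfrac b a lam m) n = fps_nth (inverse (G 0)) n" if "n \<le> m" for m
  proof -
    have "fps_X ^ Suc m dvd inverse (G 0) - cfrac b a lam m"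
      using inverse_diff_dvd[OF G_0 cfrac_denom_nth_0 cfrac_denom_tail_dvd[of G b a lam, OF G_0 G_rec], of m 0]
      by (simp add: cfrac_def fps_divide_unit cfrac_denom_nth_0)
    then obtain h where "inverse (G 0) - cfrac b a lam m = fps_X ^ Suc m * h" ..
    then have "fps_nth (inverse (G 0)) n - fps_nth (cfrac b a lam m) n = fps_nth (fps_X ^ Suc m * h) n"
      by (metis fps_sub_nth)
    also have "\<dots> = 0"
      using that by (subst fps_X_power_mult_nth) simp
    finally show ?thesis
      by simp
  qed
  then show "\<forall>\<^sub>F m in sequentially. fps_nth (cfrac b a lam m) n = fps_nth (inverse (G 0)) n"
    by (rule eventually_sequentiallyI)
qed

section \<open>q-Lommel polynomials and the finite continued fraction\<close>

text \<open>The polynomial is a tridiagonal determinant. The defining recurrence expands it at the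
  last row, this one at the first.\<close>

lemma q_lommel_rec_left:
  "q_lommel P \<nu> (Suc (Suc m)) =
     (fls_X + fls_X_inv * fls_const (1 - P \<nu>)) * q_lommel P (\<nu> + 1) (Suc m) - q_lommel P (\<nu> + 2) m"
proof (induction m rule: less_induct)
  case (less m)
  have shift: "P (\<nu> + 1 + of_nat (Suc n)) = P (\<nu> + of_nat (Suc (Suc n)))"
    "P (\<nu> + 2 + of_nat (Suc n)) = P (\<nu> + of_nat (Suc (Suc (Suc n))))"
    "P (\<nu> + 2) = P (\<nu> + of_nat (Suc (Suc 0)))" for n
    by (simp_all add: algebra_simps)
  \<comment> \<open>Two base cases, since the step uses the claim for both \<open>m - 1\<close> and
    \<open>m - 2\<close>.\<close>
  consider "m = 0" | "m = 1" | n where "m = Suc (Suc n)"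
    by (metis One_nat_def not0_implies_Suc)
  then show ?case
  proof cases
    case 1
    then show ?thesis by (simp add: algebra_simps)
  next
    case 2
    then show ?thesis
      by (simp add: ac_simps one_add_one) (simp add: algebra_simps)
  next
    case 3
    let ?c = "\<lambda>j. fls_X + fls_X_inv * fls_const (1 - P (\<nu> + of_nat j))"
    have "q_lommel P \<nu> (Suc (Suc m)) = ?c (Suc m) * q_lommel P \<nu> (Suc m) - q_lommel P \<nu> m"
      by simp
    also have "q_lommel P \<nu> (Suc m) = ?c 0 * q_lommel P (\<nu> + 1) m - q_lommel P (\<nu> + 2) (Suc n)"
      using less[of "Suc n"] 3 by simp
    also have "q_lommel P \<nu> m = ?c 0 * q_lommel P (\<nu> + 1) (Suc n) - q_lommel P (\<nu> + 2) n"
      using less[of n] 3 by simp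
    \<comment> \<open>Interchanging the two expansions leaves defining recurrences with parameters
      \<open>\<nu> + 1\<close> and \<open>\<nu> + 2\<close>, which are then folded back.\<close>
    also have "?c (Suc m) * (?c 0 * q_lommel P (\<nu> + 1) m - q_lommel P (\<nu> + 2) (Suc n))
        - (?c 0 * q_lommel P (\<nu> + 1) (Suc n) - q_lommel P (\<nu> + 2) n)
      = ?c 0 * (?c (Suc m) * q_lommel P (\<nu> + 1) m - q_lommel P (\<nu> + 1) (Suc n))
        - (?c (Suc m) * q_lommel P (\<nu> + 2) (Suc n) - q_lommel P (\<nu> + 2) n)"
      by algebra
    also have "?c (Suc m) * q_lommel P (\<nu> + 1) m - q_lommel P (\<nu> + 1) (Suc n) = q_lommel P (\<nu> + 1) (Suc m)"
      unfolding 3 q_lommel.simps shift ..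
    also have "?c (Suc m) * q_lommel P (\<nu> + 2) (Suc n) - q_lommel P (\<nu> + 2) n = q_lommel P (\<nu> + 2) m"
      unfolding 3 q_lommel.simps shift ..
    finally show ?thesis by simp
  qed
qed

text \<open>The ratio of neighbouring polynomials obeys the recursion of the denominators at t =
  z^2, up to the factor \<open>d k\<close> / z. Nonvanishing propagates along the same factorization
  and later permits forming the quotient.\<close>

lemma q_lommel_Suc_eq_cfrac_denom:
  fixes P :: "'e::comm_ring_1 \<Rightarrow> 'a::field" and \<nu> :: 'e and b a lam :: "nat \<Rightarrow> 'a"
  defines "d \<equiv> \<lambda>k. 1 - P (\<nu> + of_nat k)"
  assumes d: "\<And>k. d k \<noteq> 0"
    and b: "\<And>k. b k = - 1 / d k"
    and a: "\<And>k. a (Suc k) = 1 / (d k * d (Suc k))"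
    and lam: "\<And>k. lam k = 0"
  shows "q_lommel P (\<nu> + of_nat k) (Suc m) = fls_X_inv * fls_const (d k)
           * fps_to_fls (cfrac_denom b a lam k m oo fps_X ^ 2) * q_lommel P (\<nu> + of_nat (Suc k)) m
         \<and> q_lommel P (\<nu> + of_nat k) (Suc m) \<noteq> 0"
proof -
  define E where "E k m = fps_to_fls (cfrac_denom b a lam k m oo fps_X ^ 2)" for k m
  have E_nz: "E k m \<noteq> 0" for k m
  proof
    assume "E k m = 0"
    then have "fps_nth (cfrac_denom b a lam k m oo fps_X ^ 2) 0 = 0"
      by (simp add: E_def)
    then show False
      by (simp add: cfrac_denom_nth_0)
  qed
  have XX: "fls_X_inv * fls_X = (1 :: 'a fls)"
    by (metis fls_X_nonzero fls_inverse_X left_inverse)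
  define c where "c k = fls_const (d k)" for k
  have c_nz: "c k \<noteq> 0" for k
    using d by (simp add: c_def)
  have c_inv: "fls_const (1 / d k) = 1 / c k" for k
    by (simp add: c_def fls_inverse_const inverse_eq_divide[symmetric])
  have c_inv2: "fls_const (1 / (d k * d j)) = 1 / c k * (1 / c j)" for k j
    unfolding c_inv[symmetric] by (simp add: fls_const_mult_const)
  have E_0: "c k * E k 0 = c k + fls_X ^ 2" for k
  proof -
    have "E k 0 = 1 + 1 / c k * fls_X ^ 2"
      by (simp add: E_def b fps_compose_add_distrib fps_compose_mult_distrib fls_times_fps_to_fls
            fps_to_fls_power c_inv flip: fps_const_neg)
    then show ?thesis
      using c_nz[of k] by (simp add: field_simps)
  qed
  \<comment> \<open>Scaling by \<open>c k\<close> clears the factor 1 / \<open>d k\<close> common to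
    \<open>b k\<close> and \<open>a (Suc k)\<close>; this is z times the coefficient pattern of the
    left recurrence.\<close>
  have E_Suc: "c k * E k (Suc j) = c k + fls_X ^ 2 - fls_X ^ 2 / (c (Suc k) * E (Suc k) j)" for k j
  proof -
    let ?D = "cfrac_denom b a lam (Suc k) j"
    have D: "fps_nth (?D oo fps_X ^ 2) 0 = 1"
      by (simp add: cfrac_denom_nth_0)
    then have "subdegree (?D oo fps_X ^ 2) = 0"
      by (simp add: subdegree_eq_0_iff)
    then have "fps_to_fls (inverse ?D oo fps_X ^ 2) = inverse (E (Suc k) j)"
      by (simp add: E_def fls_inverse_fps_to_fls fps_inverse_compose cfrac_denom_nth_0)
    then have "E k (Suc j) = 1 + 1 / c k * fls_X ^ 2
        - 1 / c k * (1 / c (Suc k)) * fls_X ^ 2 * inverse (E (Suc k) j)"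
      by (simp add: E_def b a lam fps_compose_sub_distrib fps_compose_add_distrib fps_compose_mult_distrib
            fls_times_fps_to_fls fps_to_fls_power fps_divide_unit cfrac_denom_nth_0
            c_inv c_inv2 del: times_divide_eq_left times_divide_eq_right flip: fps_const_neg)
    moreover have "c k * (1 / c k) = 1"
      using c_nz by simp
    moreover have "fls_X ^ 2 / (c (Suc k) * E (Suc k) j) = fls_X ^ 2 * (1 / c (Suc k)) * inverse (E (Suc k) j)"
      by (simp add: divide_inverse)
    ultimately show ?thesis
      by algebra
  qed
  have "q_lommel P (\<nu> + of_nat k) (Suc m) = fls_X_inv * c k * E k m * q_lommel P (\<nu> + of_nat (Suc k)) m
      \<and> q_lommel P (\<nu> + of_nat k) (Suc m) \<noteq> 0"
  proof (induction m arbitrary: k)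
    case 0
    have "fls_X + fls_X_inv * c k = fls_X_inv * (c k * E k 0)"
      unfolding E_0 using XX by algebra
    moreover have "fls_X_inv * (c k * E k 0) \<noteq> 0"
      using c_nz E_nz by simp
    ultimately show ?case
      by (simp add: c_def d_def mult.assoc)
  next
    case (Suc j)
    let ?R = "q_lommel P (\<nu> + of_nat (Suc k)) (Suc j)" and ?R' = "q_lommel P (\<nu> + of_nat (Suc (Suc k))) j"
    have "?R = fls_X_inv * c (Suc k) * E (Suc k) j * ?R'" and R_nz: "?R \<noteq> 0"
      using Suc[of "Suc k"] by blast+
    \<comment> \<open>Solving the induction hypothesis for \<open>?R'\<close> turns the left
      recurrence into a multiple of \<open>?R\<close> alone, whose factor is given by
      \<open>E_Suc\<close>.\<close>
    then have "fls_X * ?R = c (Suc k) * E (Suc k) j * ?R'"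
      using XX by algebra
    then have "?R' = fls_X / (c (Suc k) * E (Suc k) j) * ?R"
      using c_nz E_nz by (simp add: field_simps)
    moreover have "q_lommel P (\<nu> + of_nat k) (Suc (Suc j)) = (fls_X + fls_X_inv * c k) * ?R - ?R'"
      using q_lommel_rec_left[of P "\<nu> + of_nat k" j] by (simp add: c_def d_def add_ac)
    moreover have "fls_X_inv * (c k * E k (Suc j)) = fls_X + fls_X_inv * c k - fls_X / (c (Suc k) * E (Suc k) j)"
      unfolding E_Suc using XX by (simp add: power2_eq_square right_diff_distrib distrib_left flip: mult.assoc)
    ultimately have "q_lommel P (\<nu> + of_nat k) (Suc (Suc j)) = fls_X_inv * (c k * E k (Suc j)) * ?R"
      by algebra
    then show ?case
      using R_nz c_nz E_nz by (simp add: mult.assoc)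
  qed
  then show ?thesis
    unfolding c_def E_def .
qed

section \<open>Hahn-Exton series and their contiguous relation\<close>

text \<open>This is \<open>\<Phi>_\<nu>(w;p)\<close> with \<open>y = p^(\<nu>+1)\<close>, as a series in \<open>w^2\<close>.\<close>
definition hahn_exton_series :: "'a::field \<Rightarrow> 'a \<Rightarrow> 'a fps" where
  "hahn_exton_series p y = Abs_fps (\<lambda>n. (-1) ^ n * p ^ (n choose 2) * p ^ n
     / (q_pochhammer p p n * q_pochhammer y p n))"

lemma q_pochhammer_0 [simp]: "q_pochhammer y p 0 = 1"
  by (simp add: q_pochhammer_def)

lemma q_pochhammer_Suc: "q_pochhammer y p (Suc n) = q_pochhammer y p n * (1 - y * p ^ n)"
  by (simp add: q_pochhammer_def)

lemma q_pochhammer_Suc_left: "q_pochhammer y p (Suc n) = (1 - y) * q_pochhammer (y * p) p n"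
  by (simp add: q_pochhammer_def prod.lessThan_Suc_shift mult.assoc del: prod.lessThan_Suc)

lemma hahn_exton_series_nth_0 [simp]: "fps_nth (hahn_exton_series p y) 0 = 1"
  by (simp add: hahn_exton_series_def numeral_2_eq_2)

text \<open>Coefficientwise, the q-Pochhammer symbols based at \<open>y\<close>,
  \<open>y * p\<close> and \<open>y * p * p\<close> differ only in boundary factors, so everything
  reduces to a rational identity in \<open>y\<close> and one power of \<open>p\<close>.\<close>

lemma hahn_exton_series_contiguous:
  fixes p y :: "'a::field"
  assumes p: "\<And>n. p ^ Suc n \<noteq> 1" and y: "\<And>n. y * p ^ n \<noteq> 1"
  shows "hahn_exton_series p y
    = (1 + fps_const (1 / (1 - y)) * fps_X) * hahn_exton_series p (y * p)
      - fps_const (1 / ((1 - y) * (1 - y * p))) * fps_X * hahn_exton_series p (y * p * p)"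
proof (rule fps_ext)
  fix n
  show "fps_nth (hahn_exton_series p y) n = fps_nth (
      (1 + fps_const (1 / (1 - y)) * fps_X) * hahn_exton_series p (y * p)
      - fps_const (1 / ((1 - y) * (1 - y * p))) * fps_X * hahn_exton_series p (y * p * p)) n"
  proof (cases n)
    case 0
    then show ?thesis by (simp add: algebra_simps)
  next
    case (Suc k)
    \<comment> \<open>\<open>A\<close> is the \<open>y\<close>-free part of coefficient
      \<open>k\<close>, and \<open>S\<close> is the product shared by all the q-Pochhammer symbols
      in \<open>y\<close>.\<close>
    define u where "u = p ^ Suc k"
    define A where "A = (-1) ^ k * p ^ (k choose 2) * p ^ k / q_pochhammer p p k"
    define S where "S = q_pochhammer (y * p) p k"
    have nz: "1 - u \<noteq> 0" "1 - y \<noteq> 0" "1 - y * p \<noteq> 0" "1 - y * u \<noteq> 0"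
      using p[of k] y[of 0] y[of 1] y[of "Suc k"] by (simp_all add: u_def)
    have S_nz: "S \<noteq> 0"
      using y[of "Suc i" for i] by (simp add: S_def q_pochhammer_def mult.assoc)
    \<comment> \<open>Raising \<open>k\<close> by one adds \<open>k\<close> to the binomial
      exponent; with the extra factor \<open>p\<close> this gives \<open>u\<close>.\<close>
    have A_Suc: "(-1) ^ Suc k * p ^ (Suc k choose 2) * p ^ Suc k / q_pochhammer p p (Suc k) = - A * u / (1 - u)"
      by (simp add: A_def u_def q_pochhammer_Suc numeral_2_eq_2 power_add)
    have c1: "fps_nth (hahn_exton_series p y) (Suc k) = - A * u / (1 - u) / ((1 - y) * S)"
      unfolding A_Suc[symmetric]
      by (simp add: hahn_exton_series_def q_pochhammer_Suc_left[of y] S_def del: power_Suc)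
    have c2: "fps_nth (hahn_exton_series p (y * p)) (Suc k) = - A * u / (1 - u) / (S * (1 - y * u))"
      unfolding A_Suc[symmetric]
      by (simp add: hahn_exton_series_def q_pochhammer_Suc[of "y * p"] S_def u_def mult.assoc)
    have c3: "fps_nth (hahn_exton_series p (y * p)) k = A / S"
      by (simp add: hahn_exton_series_def A_def S_def)
    have "(1 - y * p) * q_pochhammer (y * p * p) p k = S * (1 - y * u)"
      using q_pochhammer_Suc_left[of "y * p" p k] q_pochhammer_Suc[of "y * p" p k]
      by (simp add: S_def u_def mult.assoc)
    then have "q_pochhammer (y * p * p) p k = S * (1 - y * u) / (1 - y * p)"
      using nz by (simp add: field_simps)
    then have c4: "fps_nth (hahn_exton_series p (y * p * p)) k = A * (1 - y * p) / (S * (1 - y * u))"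
      by (simp add: hahn_exton_series_def A_def)
    have "- A * u / (1 - u) / ((1 - y) * S) = - A * u / (1 - u) / (S * (1 - y * u)) + 1 / (1 - y) * (A / S)
        - 1 / ((1 - y) * (1 - y * p)) * (A * (1 - y * p) / (S * (1 - y * u)))"
      using nz S_nz by (simp add: divide_simps) algebra
    moreover have "fps_nth ((1 + fps_const s * fps_X) * f - fps_const t * fps_X * g) (Suc k)
        = fps_nth f (Suc k) + s * fps_nth f k - t * fps_nth g k" for f g and s t :: 'a
      by (simp add: distrib_right mult.assoc)
    ultimately show ?thesis
      unfolding Suc c1 by (simp only: c2 c3 c4)
  qed
qed

lemma lim_cfrac_eq_hahn_exton:
  fixes p y :: "'a::field" and b a lam :: "nat \<Rightarrow> 'a"
  assumes p: "\<And>n. p ^ Suc n \<noteq> 1" and y: "\<And>n. y * p ^ n \<noteq> 1"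
    and b: "\<And>k. b k = - 1 / (1 - y * p ^ k)"
    and a: "\<And>k. a (Suc k) = 1 / ((1 - y * p ^ k) * (1 - y * p ^ Suc k))"
    and lam: "\<And>k. lam k = 0"
  shows "lim (cfrac b a lam) = hahn_exton_series p (y * p) / hahn_exton_series p y"
proof -
  define F where "F k = hahn_exton_series p (y * p ^ k)" for k
  have F_0: "fps_nth (F k) 0 = 1" for k
    by (simp add: F_def)
  then have F_inv: "F k * inverse (F k) = 1" for k
    by (simp add: inverse_mult_eq_1')
  have rec: "F k = (1 - fps_const (b k) * fps_X) * F (Suc k)
      - fps_const (a (Suc k)) * fps_X * F (Suc (Suc k))" for k
    using hahn_exton_series_contiguous[of p "y * p ^ k", OF p]  y[of "k + i" for i]
    by (simp add: F_def b a power_add mult_ac flip: fps_const_neg)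
  \<comment> \<open>Dividing the contiguous relation by \<open>F (Suc k)\<close> makes these
    quotients the tails.\<close>
  define G where "G k = F k * inverse (F (Suc k))" for k
  have G_0: "fps_nth (G k) 0 = 1" for k
    by (simp add: G_def F_0)
  have G_inv: "inverse (G k) = F (Suc k) * inverse (F k)" for k
    by (simp add: G_def fps_inverse_mult F_0)
  have *: "G k = 1 - fps_const (b k) * fps_X
      - fps_const (a (Suc k)) * fps_X * (F (Suc (Suc k)) * inverse (F (Suc k)))" for k
    using rec[of k] F_inv[of "Suc k"] unfolding G_def by algebra
  have G_rec: "G k = 1 - fps_const (b k) * fps_X
      - (fps_const (a (Suc k)) * fps_X + fps_const (lam (Suc k)) * fps_X ^ 2) / G (Suc k)" for k
    by (subst *) (simp add: fps_divide_unit G_0 G_inv lam)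
  have "lim (cfrac b a lam) = inverse (G 0)"
    by (rule lim_cfrac_eq_inverse_tail[of G b a lam, OF G_0 G_rec])
  also have "\<dots> = F 1 / F 0"
    by (simp add: G_inv fps_divide_unit F_0)
  finally show ?thesis
    by (simp add: F_def)
qed

section \<open>Passage from q to the base p = 1/q, and both identities\<close>

theorem theorem5p1:
  fixes Q :: "'e::comm_ring_1 \<Rightarrow> 'a::field"  \<comment> \<open>\<open>Q s\<close> is the power of \<open>q\<close> with exponent \<open>s\<close>\<close>
    and \<nu> :: 'e
    and b a lam :: "nat \<Rightarrow> 'a"
  assumes Q_zero: "Q 0 = 1"
    and Q_add: "\<And>s t. Q (s + t) = Q s * Q t"
    and q_generic: "\<And>n::nat. n \<ge> 1 \<Longrightarrow> Q (of_nat n) \<noteq> 1"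
    and \<nu>_generic: "\<And>n::nat. n \<ge> 1 \<Longrightarrow> Q (\<nu> + of_nat n) \<noteq> 1"
    and b: "\<And>n. b n = Q (\<nu> + of_nat n + 1) / (1 - Q (\<nu> + of_nat n + 1))"
    and a: "\<And>n. a n = Q (2 * \<nu> + 2 * of_nat n + 1)
                        / ((1 - Q (\<nu> + of_nat n)) * (1 - Q (\<nu> + of_nat n + 1)))"
    and lam: "\<And>n. lam n = 0"
  shows "(\<forall>m. q_lommel (recip_base Q) (\<nu> + 2) m / q_lommel (recip_base Q) (\<nu> + 1) (m + 1)
              = fps_to_fls (fps_const (Q (\<nu> + 1) / (Q (\<nu> + 1) - 1)) * fps_X
                              * (Abs_fps (mu_le m b a lam) oo fps_X ^ 2)))
         \<and> hahn_exton_ratio (recip_base Q) \<nu>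
              = fps_const (Q (\<nu> + 1) / (Q (\<nu> + 1) - 1)) * fps_X
                  * (Abs_fps (mu b a lam) oo fps_X ^ 2)"
proof (intro conjI allI)
  define P where "P = recip_base Q"
  define y where "y = P (\<nu> + 1)"
  define p where "p = P 1"
  have P_inv: "P s = 1 / Q s" and Q_nz: "Q s \<noteq> 0" for s
    using Q_add[of s "- s"] by (auto simp: P_def recip_base_def Q_zero eq_divide_eq mult.commute)
  have P_add: "P (s + t) = P s * P t" for s t
    by (simp add: P_inv Q_add)
  have P_of_nat: "P (of_nat k) = p ^ k" for k
    by (induction k) (simp_all add: P_add p_def, simp add: P_inv Q_zero)
  have P_shift: "P (\<nu> + 1 + of_nat k) = y * p ^ k" for k
    unfolding P_add[of "\<nu> + 1"] P_of_nat y_def ..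
  have yp: "y * p ^ k = 1 / Q (\<nu> + of_nat k + 1)" for k
    unfolding P_shift[symmetric] P_inv by (simp add: add_ac)
  have Q_ne: "Q (\<nu> + of_nat k + 1) \<noteq> 1" for k
    using \<nu>_generic[of "Suc k"] by (simp add: add_ac)
  have y_ne: "y * p ^ k \<noteq> 1" for k
    using Q_ne[of k] by (simp add: yp divide_eq_1_iff)
  have p_ne: "p ^ Suc k \<noteq> 1" for k
    using q_generic[of "Suc k"] by (simp add: P_inv divide_eq_1_iff del: of_nat_Suc flip: P_of_nat power_Suc)
  \<comment> \<open>With p^s = 1 / q^s, one has q^s / (1 - q^s) = - 1 / (1 - p^s).\<close>
  have b': "b k = - 1 / (1 - y * p ^ k)" for k
    using Q_nz[of "\<nu> + of_nat k + 1"] Q_ne[of k] by (simp add: b yp divide_simps) algebra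
  \<comment> \<open>The exponent splits into two consecutive ones, each giving a factor as in
    \<open>b'\<close>; the signs cancel. From index 1 on, genericity makes both denominators
    nonzero, whereas \<open>1 - Q \<nu>\<close> in \<open>a 0\<close> may vanish.\<close>
  have a': "a (Suc k) = 1 / ((1 - y * p ^ k) * (1 - y * p ^ Suc k))" for k
  proof -
    have "2 * \<nu> + 2 * of_nat (Suc k) + 1 = (\<nu> + of_nat k + 1) + (\<nu> + of_nat (Suc k) + 1)"
      by (simp add: algebra_simps)
    then have "Q (2 * \<nu> + 2 * of_nat (Suc k) + 1) = Q (\<nu> + of_nat k + 1) * Q (\<nu> + of_nat (Suc k) + 1)"
      by (simp only: Q_add)
    moreover have "\<nu> + of_nat (Suc k) = \<nu> + of_nat k + 1"
      by (simp add: add_ac)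
    ultimately have "a (Suc k) = Q (\<nu> + of_nat k + 1) * Q (\<nu> + of_nat (Suc k) + 1)
        / ((1 - Q (\<nu> + of_nat k + 1)) * (1 - Q (\<nu> + of_nat (Suc k) + 1)))"
      unfolding a[of "Suc k"] by (simp only:)
    then show ?thesis
      unfolding yp using Q_nz[of "\<nu> + of_nat k + 1"] Q_ne[of k]
        Q_nz[of "\<nu> + of_nat (Suc k) + 1"] Q_ne[of "Suc k"]
      by (simp add: divide_simps del: of_nat_Suc) algebra
  qed
  have pref: "Q (\<nu> + 1) / (Q (\<nu> + 1) - 1) = 1 / (1 - y)"
    using Q_nz[of "\<nu> + 1"] Q_ne[of 0] by (simp add: y_def P_inv divide_simps)
  show "q_lommel (recip_base Q) (\<nu> + 2) m / q_lommel (recip_base Q) (\<nu> + 1) (m + 1)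
      = fps_to_fls (fps_const (Q (\<nu> + 1) / (Q (\<nu> + 1) - 1)) * fps_X
          * (Abs_fps (mu_le m b a lam) oo fps_X ^ 2))" for m
  proof -
    let ?D = "cfrac_denom b a lam 0 m"
    have "Abs_fps (mu_le m b a lam) = inverse ?D"
      by (rule fps_ext) (simp add: mu_le_def cfrac_def fps_divide_unit cfrac_denom_nth_0)
    moreover have "subdegree (?D oo fps_X ^ 2) = 0"
      by (simp add: subdegree_eq_0_iff cfrac_denom_nth_0)
    ultimately have mu: "fps_to_fls (Abs_fps (mu_le m b a lam) oo fps_X ^ 2)
        = inverse (fps_to_fls (?D oo fps_X ^ 2))"
      by (simp add: fls_inverse_fps_to_fls fps_inverse_compose cfrac_denom_nth_0)
    have y_ne': "1 - y * p ^ k \<noteq> 0" for k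
      using y_ne by simp
    have shift: "\<nu> + 1 + of_nat 0 = \<nu> + 1" "\<nu> + 1 + of_nat (Suc 0) = \<nu> + 2"
      by (simp_all add: add.assoc)
    \<comment> \<open>The ratio formula is taken at level 0 with parameter \<open>\<nu> + 1\<close>,
      so its \<open>d k\<close> is \<open>1 - y * p ^ k\<close>.\<close>
    have "q_lommel P (\<nu> + 1) (Suc m) = fls_X_inv * fls_const (1 - y)
        * fps_to_fls (?D oo fps_X ^ 2) * q_lommel P (\<nu> + 2) m
      \<and> q_lommel P (\<nu> + 1) (Suc m) \<noteq> 0"
      by (rule q_lommel_Suc_eq_cfrac_denom[of P "\<nu> + 1" b a lam 0 m, unfolded P_shift,
            OF y_ne' b' a' lam, unfolded shift power_0 mult_1_right])
    then have "q_lommel P (\<nu> + 2) m / q_lommel P (\<nu> + 1) (Suc m)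
        = inverse (fls_X_inv * fls_const (1 - y) * fps_to_fls (?D oo fps_X ^ 2))"
      by (auto simp: inverse_eq_divide)
    also have "\<dots> = fls_const (1 / (1 - y)) * fls_X * inverse (fps_to_fls (?D oo fps_X ^ 2))"
      by (simp add: fls_inverse_X_inv fls_inverse_const inverse_eq_divide[of "1 - y"])
    finally show ?thesis
      unfolding fls_times_fps_to_fls mu pref by (simp add: P_def)
  qed
  have Phi: "hahn_exton_Phi P (\<nu> + of_nat k) = hahn_exton_series p (y * p ^ k) oo fps_X ^ 2" for k
    using P_shift[of k] by (simp add: hahn_exton_Phi_def hahn_exton_series_def p_def add_ac)
  have "Abs_fps (mu b a lam) = hahn_exton_series p (y * p) / hahn_exton_series p y"
    unfolding lim_cfrac_eq_hahn_exton[of p y b a lam, OF p_ne y_ne b' a' lam, symmetric]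
    by (rule fps_ext) (simp add: mu_def)
  then show "hahn_exton_ratio (recip_base Q) \<nu> = fps_const (Q (\<nu> + 1) / (Q (\<nu> + 1) - 1)) * fps_X
      * (Abs_fps (mu b a lam) oo fps_X ^ 2)"
    unfolding hahn_exton_ratio_def pref P_def[symmetric]
    using Phi[of 0] Phi[of 1] by (simp add: y_def fps_divide_compose)
qed

end
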